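(* Let $n>3$ be an integer. The Hilbert series $H_n$ of $\overline{FK}_{C_n}(n)$ is the $q$-Lucas polynomial $L_n(q)$: $$H_n=\sum_{k=0}^{\lfloor n/2\rfloor}\frac{n}{n-k}\binom{n-k}{k}q^k=L_n(q).$$
   Context: Let $F$ be a field and $n>3$. $\overline{FK}_{C_n}(n)$ is the quotient of the Fomin-Kirillov algebra $FK(n)$ by the ideal generated by the $x_{ij}$ for which $\{i,j\}$ is not an edge of the $n$-cycle $C_n$ (vertices $1,\dots,n$, edges $\overline{12},\overline{23},\dots,\overline{n-1,n},\overline{1n}$). Explicitly, it is the associative unital $F$-algebra on generators $x_{1n}=-x_{n1}$ and $x_{m,m+1}=-x_{m+1,m}$ ($1\le m\le n-1$), that is, the free associative algebra on the $n$ letters $x_{12},x_{23},\dots,x_{n-1,n},x_{1n}$ modulo the two-sided ideal generated by the relations - $x_{m,m+1}^2=0$ for $1\le m\le n-1$, and $x_{1n}^2=0$; - $x_{m,m+1}x_{m+1,m+2}=0$ and $x_{m+1,m+2}x_{m,m+1}=0$ for $1\le m\le n-2$; - $x_{n-1,n}x_{1n}=0$, $x_{1n}x_{n-1,n}=0$, $x_{12}x_{1n}=0$, $x_{1n}x_{12}=0$; - $x_{m,m+1}x_{l,l+1}-x_{l,l+1}x_{m,m+1}=0$ for $1\le m\le l-2$, $3\le l\le n-1$; - $x_{m,m+1}x_{1n}-x_{1n}x_{m,m+1}=0$ for $2\le m\le n-2$. The relations are homogeneous, so the algebra is graded by usual degree (each generator has degree 1): $\overline{FK}_{C_n}(n)=\bigoplus_{d\ge0}\overline{FK}^{(d)}_{C_n}(n)$.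 Its Hilbert series is $H_n=\sum_{d\ge 0}\dim_F\overline{FK}^{(d)}_{C_n}(n)\,q^d$. The $q$-Lucas polynomial is $L_n(q)=\sum_{k=0}^{\lfloor n/2\rfloor}\frac{n}{n-k}\binom{n-k}{k}q^k$ for $n\ge 1$ (with $L_0=2$). *)

theory Defs
  imports
    "HOL-Algebra.Embedded_Algebras"
    "HOL-Library.Poly_Mapping"
    "HOL-Computational_Algebra.Polynomial_FPS"
begin

section \<open>Free associative algebras\<close>

text \<open>
  Words form a monoid under concatenation, so the multiplication that \<^theory>\<open>HOL-Library.Poly_Mapping\<close>
  provides on finitely supported functions from words to a field is that of the monoid algebra of the
  free monoid, which is the free associative unital algebra.
\<close>

instantiation list :: (type) monoid_add
begin

definition zero_list :: "'a list" where "0 = []"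

definition plus_list :: "'a list \<Rightarrow> 'a list \<Rightarrow> 'a list" where "xs + ys = xs @ ys"

instance by standard (simp_all add: zero_list_def plus_list_def)

end

definition free_algebra :: "'x set \<Rightarrow> ('x list \<Rightarrow>\<^sub>0 'f::field) ring" where
  "free_algebra X =
     \<lparr>carrier = {f. Poly_Mapping.keys f \<subseteq> lists X}, monoid.mult = (*), one = 1, zero = 0, add = (+)\<rparr>"

lemma ring_free_algebra: "ring (free_algebra X :: ('x list \<Rightarrow>\<^sub>0 'f::field) ring)"
proof (rule ringI)
  show "abelian_group (free_algebra X :: ('x list \<Rightarrow>\<^sub>0 'f) ring)"
  proof (rule abelian_groupI)
    fix f g :: "'x list \<Rightarrow>\<^sub>0 'f"
    assume "f \<in> carrier (free_algebra X)" "g \<in> carrier (free_algebra X)"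
    then show "f \<oplus>\<^bsub>free_algebra X\<^esub> g \<in> carrier (free_algebra X)"
      using Poly_Mapping.keys_add[of f g] by (auto simp: free_algebra_def)
  next
    fix f :: "'x list \<Rightarrow>\<^sub>0 'f"
    assume "f \<in> carrier (free_algebra X)"
    then have "- f \<in> carrier (free_algebra X)"
      by (simp add: free_algebra_def)
    then show "\<exists>g\<in>carrier (free_algebra X). g \<oplus>\<^bsub>free_algebra X\<^esub> f = \<zero>\<^bsub>free_algebra X\<^esub>"
      by (intro bexI[of _ "- f"]) (simp_all add: free_algebra_def)
  qed (simp_all add: free_algebra_def ac_simps)
next
  show "monoid (free_algebra X :: ('x list \<Rightarrow>\<^sub>0 'f) ring)"
  proof (rule monoidI)
    fix f g :: "'x list \<Rightarrow>\<^sub>0 'f"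
    assume fg: "f \<in> carrier (free_algebra X)" "g \<in> carrier (free_algebra X)"
    have "w \<in> lists X" if "w \<in> Poly_Mapping.keys (f * g)" for w
    proof -
      from that obtain u v where "u \<in> Poly_Mapping.keys f" "v \<in> Poly_Mapping.keys g" "w = u + v"
        using keys_mult[of f g] by blast
      with fg have "u \<in> lists X" "v \<in> lists X"
        by (auto simp only: free_algebra_def partial_object.simps mem_Collect_eq subset_iff)
      with \<open>w = u + v\<close> show ?thesis
        by (simp add: plus_list_def)
    qed
    then show "f \<otimes>\<^bsub>free_algebra X\<^esub> g \<in> carrier (free_algebra X)"
      by (auto simp add: free_algebra_def)
  next
    show "\<one>\<^bsub>free_algebra X\<^esub> \<in> carrier (free_algebra X :: ('x list \<Rightarrow>\<^sub>0 'f) ring)"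
      by (simp add: free_algebra_def zero_list_def)
  qed (simp_all add: free_algebra_def mult.assoc)
qed (simp_all add: free_algebra_def distrib_left distrib_right)


section \<open>The algebra attached to the cycle\<close>

text \<open>The letter \<^term>\<open>(i, j)\<close> with \<^term>\<open>i < j\<close> stands for the generator $x_{ij}$;
  $x_{ji}$ is only notation for $-x_{ij}$ and is not a separate letter.\<close>

definition cycle_edges :: "nat \<Rightarrow> (nat \<times> nat) set" where
  "cycle_edges n = insert (1, n) {(m, m + 1) | m. 1 \<le> m \<and> m \<le> n - 1}"

definition gen :: "nat \<Rightarrow> nat \<Rightarrow> ((nat \<times> nat) list \<Rightarrow>\<^sub>0 'f::field)" where
  "gen i j = Poly_Mapping.single [(i, j)] 1"

definition fk_relations :: "nat \<Rightarrow> ((nat \<times> nat) list \<Rightarrow>\<^sub>0 'f::field) set" where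
  "fk_relations n =
     {gen m (m + 1) * gen m (m + 1) | m. 1 \<le> m \<and> m \<le> n - 1} \<union>
     {gen 1 n * gen 1 n} \<union>
     {gen m (m + 1) * gen (m + 1) (m + 2) | m. 1 \<le> m \<and> m \<le> n - 2} \<union>
     {gen (m + 1) (m + 2) * gen m (m + 1) | m. 1 \<le> m \<and> m \<le> n - 2} \<union>
     {gen (n - 1) n * gen 1 n, gen 1 n * gen (n - 1) n,
      gen 1 2 * gen 1 n, gen 1 n * gen 1 2} \<union>
     {gen m (m + 1) * gen l (l + 1) - gen l (l + 1) * gen m (m + 1) | m l.
        1 \<le> m \<and> m \<le> l - 2 \<and> 3 \<le> l \<and> l \<le> n - 1} \<union>
     {gen m (m + 1) * gen 1 n - gen 1 n * gen m (m + 1) | m. 2 \<le> m \<and> m \<le> n - 2}"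

definition fk_ideal :: "nat \<Rightarrow> ((nat \<times> nat) list \<Rightarrow>\<^sub>0 'f::field) set" where
  "fk_ideal n = Idl\<^bsub>free_algebra (cycle_edges n)\<^esub> (fk_relations n)"

definition fk_cycle :: "nat \<Rightarrow> ((nat \<times> nat) list \<Rightarrow>\<^sub>0 'f::field) set ring" where
  "fk_cycle n = free_algebra (cycle_edges n) Quot fk_ideal n"

definition fk_class :: "nat \<Rightarrow> ((nat \<times> nat) list \<Rightarrow>\<^sub>0 'f::field) \<Rightarrow> ((nat \<times> nat) list \<Rightarrow>\<^sub>0 'f) set" where
  "fk_class n f = fk_ideal n +>\<^bsub>free_algebra (cycle_edges n)\<^esub> f"

text \<open>The copy of the ground field inside the quotient. The library's
  \<^const>\<open>ring.dimension\<close> measures dimension over a subfield of the ring, acting by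
  multiplication.\<close>

definition fk_scalars :: "nat \<Rightarrow> ((nat \<times> nat) list \<Rightarrow>\<^sub>0 'f::field) set set" where
  "fk_scalars n = range (\<lambda>c. fk_class n (Poly_Mapping.single [] c))"

definition fk_component :: "nat \<Rightarrow> nat \<Rightarrow> ((nat \<times> nat) list \<Rightarrow>\<^sub>0 'f::field) set set" where
  "fk_component n d =
     fk_class n ` {f \<in> carrier (free_algebra (cycle_edges n)).
                     \<forall>w \<in> Poly_Mapping.keys f. length w = d}"

text \<open>\<^const>\<open>ring.dimension\<close> is a relation; the description below is meaningful when the
  component is finite-dimensional.\<close>

definition fk_dim :: "'f::field itself \<Rightarrow> nat \<Rightarrow> nat \<Rightarrow> nat" where
  "fk_dim F n d =
     (THE k. ring.dimension (fk_cycle n) k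
               (fk_scalars n :: ((nat \<times> nat) list \<Rightarrow>\<^sub>0 'f) set set) (fk_component n d))"

definition hilbert_series :: "'f::field itself \<Rightarrow> nat \<Rightarrow> rat fps" where
  "hilbert_series F n = Abs_fps (\<lambda>d. of_nat (fk_dim F n d))"


section \<open>Lucas polynomials\<close>

definition q_lucas :: "nat \<Rightarrow> rat poly" where
  "q_lucas n =
     (if n = 0 then [:2:]
      else (\<Sum>k = 0..n div 2. Polynomial.monom (of_nat n / of_nat (n - k) * of_nat ((n - k) choose k)) k))"

end

theory Submission
  imports Defs
begin

text \<open>
  The generators are the edges of the \<open>n\<close>-cycle. Two edges that share a vertex, in particular an edge
  and itself, multiply to zero, and two disjoint edges commute. A word in the edges therefore
  vanishes in the quotient unless its letters are distinct and pairwise disjoint, and then it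
  depends only on the set of its letters, which is a matching of the cycle. So the component of degree
  \<open>d\<close> is spanned by one word for each matching with \<open>d\<close> edges
  (\<open>homogeneous_reduction\<close>).

  These words are linearly independent. For a matching \<open>S\<close>, let \<open>set_coeff S f\<close> be the sum of the
  coefficients in \<open>f\<close> of all arrangements of \<open>S\<close>. This functional vanishes on the relations:
  no arrangement of a matching occurs in a product of two edges that meet, and the two words of a
  commutator are arrangements of the same set. Moreover
  \<open>set_coeff S (u f) = set_coeff (S - set u) f\<close> for every word \<open>u\<close> that arranges a subset of \<open>S\<close>, while
  \<open>set_coeff S (u f) = 0\<close> for all other \<open>u\<close>, and the same holds on the right. Subsets of matchings are
  matchings, so the elements on which all these functionals vanish form a two-sided ideal, which must
  contain the ideal of the relations (\<open>set_coeff_ideal\<close>). On the word chosen for a matching \<open>T\<close>, the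
  functional of \<open>S\<close> is \<open>1\<close> if \<open>S = T\<close> and \<open>0\<close> otherwise.

  Nothing in this depends on the cycle: the argument is carried out for an arbitrary finite set of
  letters with a reflexive and symmetric conflict relation, and the dimension in degree \<open>d\<close> is the
  number of conflict-free sets with \<open>d\<close> letters (\<open>dimension_component\<close>).

  It remains to count the matchings of the cycle. Number the edges \<open>1, \<dots>, n\<close> around the cycle. A matching
  of size \<open>d > 0\<close> either avoids the edge \<open>n\<close>, and is a set without two consecutive numbers in
  \<open>{1..n-1}\<close>, or it contains \<open>n\<close> and the rest is such a set in \<open>{2..n-2}\<close>. This gives
  \<open>(n-d choose d) + (n-d-1 choose d-1) = n/(n-d) * (n-d choose d)\<close>.
\<close>

section \<open>Words in the free algebra\<close>

abbreviation word :: "'x list \<Rightarrow> ('x list \<Rightarrow>\<^sub>0 'f::field)" where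
  "word w \<equiv> Poly_Mapping.single w 1"

lemma single_mult_single_words:
  "Poly_Mapping.single u a * Poly_Mapping.single v b = Poly_Mapping.single (u @ v) (a * b :: 'f::field)"
  by (simp add: mult_single plus_list_def)

lemma sum_single_lookup: "(\<Sum>w\<in>Poly_Mapping.keys f. Poly_Mapping.single w (Poly_Mapping.lookup f w)) = f"
  by (rule poly_mapping_eqI)
     (auto simp: lookup_sum lookup_single when_def in_keys_iff if_distrib cong: if_cong)

lemma carrier_free_algebra: "f \<in> carrier (free_algebra X) \<longleftrightarrow> (\<forall>w\<in>Poly_Mapping.keys f. set w \<subseteq> X)"
  by (auto simp: free_algebra_def lists_eq_set)

lemma free_algebra_ops:
  "x \<otimes>\<^bsub>free_algebra X\<^esub> y = x * y" "x \<oplus>\<^bsub>free_algebra X\<^esub> y = x + y"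
  "\<one>\<^bsub>free_algebra X\<^esub> = 1" "\<zero>\<^bsub>free_algebra X\<^esub> = 0"
  by (simp_all add: free_algebra_def)

lemma single_in_free_algebra:
  "set w \<subseteq> X \<Longrightarrow> Poly_Mapping.single w a \<in> carrier (free_algebra X)"
  by (cases "a = 0") (auto simp: carrier_free_algebra)

lemma minus_free_algebra:
  assumes "f \<in> carrier (free_algebra X)" "g \<in> carrier (free_algebra X)"
  shows "f \<ominus>\<^bsub>free_algebra X\<^esub> g = f - g"
proof -
  interpret ring "free_algebra X" by (rule ring_free_algebra)
  have "- g \<in> carrier (free_algebra X)"
    using assms by (simp add: carrier_free_algebra)
  then have "\<ominus>\<^bsub>free_algebra X\<^esub> g = - g"
    using assms by (intro minus_equality) (simp_all add: free_algebra_ops)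
  then show ?thesis
    by (simp add: a_minus_def free_algebra_ops)
qed

text \<open>
  For finite \<open>S\<close> this is the coefficient of the product of the letters in \<open>S\<close>, each taken once, in the
  image of \<open>f\<close> in the commutative polynomial ring.
\<close>

definition set_coeff :: "'x set \<Rightarrow> ('x list \<Rightarrow>\<^sub>0 'f::field) \<Rightarrow> 'f" where
  "set_coeff S f = (\<Sum>w | distinct w \<and> set w = S. Poly_Mapping.lookup f w)"

lemma finite_arrangements: "finite {w. distinct w \<and> set w = S}"
proof (cases "finite S")
  case True
  then show ?thesis
    by (intro finite_subset[OF _ finite_subset_distinct]) auto
next
  case False
  then have "{w. distinct w \<and> set w = S} = {}" by auto
  then show ?thesis by (metis finite.emptyI)
qed

lemma set_coeff_zero [simp]: "set_coeff S 0 = 0"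
  by (simp add: set_coeff_def)

lemma set_coeff_add: "set_coeff S (f + g) = set_coeff S f + set_coeff S g"
  by (simp add: set_coeff_def lookup_add sum.distrib)

lemma set_coeff_diff: "set_coeff S (f - g) = set_coeff S f - set_coeff S g"
  by (simp add: set_coeff_def lookup_minus sum_subtractf)

lemma set_coeff_sum: "set_coeff S (sum f A) = (\<Sum>a\<in>A. set_coeff S (f a))"
  unfolding set_coeff_def lookup_sum by (rule sum.swap)

lemma set_coeff_single:
  "set_coeff S (Poly_Mapping.single w a) = (if distinct w \<and> set w = S then a else 0)"
  by (simp add: set_coeff_def lookup_single when_def finite_arrangements if_distrib cong: if_cong)

lemma set_coeff_eq_zero: "(\<And>w. w \<in> Poly_Mapping.keys f \<Longrightarrow> set w \<noteq> S) \<Longrightarrow> set_coeff S f = 0"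
  unfolding set_coeff_def by (rule sum.neutral) (auto simp: in_keys_iff)

text \<open>
  A word \<open>u @ v\<close> arranges \<open>S\<close> exactly if \<open>u\<close> arranges a subset of \<open>S\<close> and \<open>v\<close> arranges the rest.
  The statement is linear in \<open>f\<close>, so words suffice.
\<close>

lemma set_coeff_single_mult:
  "set_coeff S (Poly_Mapping.single u a * f) =
     (if distinct u \<and> set u \<subseteq> S then a * set_coeff (S - set u) f else 0)"
proof -
  have "set_coeff S (Poly_Mapping.single u a * Poly_Mapping.single v b) =
     (if distinct u \<and> set u \<subseteq> S then a * set_coeff (S - set u) (Poly_Mapping.single v b) else 0)" for v b
    by (auto simp: single_mult_single_words set_coeff_single)
  then have "set_coeff S (Poly_Mapping.single u a *
        (\<Sum>w\<in>Poly_Mapping.keys f. Poly_Mapping.single w (Poly_Mapping.lookup f w))) =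
     (if distinct u \<and> set u \<subseteq> S then a * set_coeff (S - set u)
        (\<Sum>w\<in>Poly_Mapping.keys f. Poly_Mapping.single w (Poly_Mapping.lookup f w)) else 0)"
    by (cases "distinct u \<and> set u \<subseteq> S") (auto simp: sum_distrib_left set_coeff_sum)
  then show ?thesis by (simp add: sum_single_lookup)
qed

lemma set_coeff_mult_single:
  "set_coeff S (f * Poly_Mapping.single u a) =
     (if distinct u \<and> set u \<subseteq> S then set_coeff (S - set u) f * a else 0)"
proof -
  have "set_coeff S (Poly_Mapping.single v b * Poly_Mapping.single u a) =
     (if distinct u \<and> set u \<subseteq> S then set_coeff (S - set u) (Poly_Mapping.single v b) * a else 0)" for v b
    by (auto simp: single_mult_single_words set_coeff_single)
  then have "set_coeff S ((\<Sum>w\<in>Poly_Mapping.keys f. Poly_Mapping.single w (Poly_Mapping.lookup f w)) *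
        Poly_Mapping.single u a) =
     (if distinct u \<and> set u \<subseteq> S then set_coeff (S - set u)
        (\<Sum>w\<in>Poly_Mapping.keys f. Poly_Mapping.single w (Poly_Mapping.lookup f w)) * a else 0)"
    by (cases "distinct u \<and> set u \<subseteq> S") (auto simp: sum_distrib_right set_coeff_sum)
  then show ?thesis by (simp add: sum_single_lookup)
qed


section \<open>The algebra of independent sets\<close>

text \<open>
  Relations between letters of a conflict graph: conflicting letters annihilate each other and all
  others commute. For each commuting pair, only one of the two commutators, which differ by
  a sign, has to be among the relations.
\<close>

locale independence_algebra =
  fixes X :: "'x set" and conf :: "'x \<Rightarrow> 'x \<Rightarrow> bool" and R :: "('x list \<Rightarrow>\<^sub>0 'f::field) set"
  assumes finite_letters: "finite X"
    and conf_refl: "a \<in> X \<Longrightarrow> conf a a"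
    and conf_sym: "a \<in> X \<Longrightarrow> b \<in> X \<Longrightarrow> conf a b \<Longrightarrow> conf b a"
    and relation_cases: "r \<in> R \<Longrightarrow> \<exists>a\<in>X. \<exists>b\<in>X.
          (if conf a b then r = word [a, b] else r = word [a, b] - word [b, a])"
    and conflict_relation: "a \<in> X \<Longrightarrow> b \<in> X \<Longrightarrow> conf a b \<Longrightarrow> word [a, b] \<in> R"
    and commuting_relation: "a \<in> X \<Longrightarrow> b \<in> X \<Longrightarrow> \<not> conf a b \<Longrightarrow>
          word [a, b] - word [b, a] \<in> R \<or> word [b, a] - word [a, b] \<in> R"
begin

abbreviation A :: "('x list \<Rightarrow>\<^sub>0 'f) ring" where "A \<equiv> free_algebra X"

definition I :: "('x list \<Rightarrow>\<^sub>0 'f) set" where "I = Idl\<^bsub>A\<^esub> R"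

definition cls :: "('x list \<Rightarrow>\<^sub>0 'f) \<Rightarrow> ('x list \<Rightarrow>\<^sub>0 'f) set" where "cls f = I +>\<^bsub>A\<^esub> f"

definition scalars :: "('x list \<Rightarrow>\<^sub>0 'f) set set" where
  "scalars = range (\<lambda>c. cls (Poly_Mapping.single [] c))"

definition indep :: "'x set \<Rightarrow> bool" where
  "indep S \<longleftrightarrow> S \<subseteq> X \<and> (\<forall>a\<in>S. \<forall>b\<in>S. conf a b \<longrightarrow> a = b)"

lemma relations_in_carrier: "R \<subseteq> carrier A"
proof
  fix r assume "r \<in> R"
  then obtain a b where ab: "a \<in> X" "b \<in> X" and "r = word [a, b] \<or> r = word [a, b] - word [b, a]"
    using relation_cases by meson
  moreover have "\<forall>w\<in>Poly_Mapping.keys (word [a, b] - word [b, a] :: 'x list \<Rightarrow>\<^sub>0 'f). set w \<subseteq> X"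
    using keys_diff[of "word [a, b] :: 'x list \<Rightarrow>\<^sub>0 'f" "word [b, a]"] ab by fastforce
  ultimately show "r \<in> carrier A"
    by (auto simp: carrier_free_algebra)
qed

lemma ideal_I: "ideal I A"
  unfolding I_def by (rule ring.genideal_ideal[OF ring_free_algebra relations_in_carrier])

lemma R_subset_I: "R \<subseteq> I"
  unfolding I_def by (rule ring.genideal_self[OF ring_free_algebra relations_in_carrier])

lemma I_add: "f \<in> I \<Longrightarrow> g \<in> I \<Longrightarrow> f + g \<in> I"
  using additive_subgroup.a_closed[OF ideal.axioms(1)[OF ideal_I]] by (simp add: free_algebra_ops)

lemma I_zero: "0 \<in> I"
  using additive_subgroup.zero_closed[OF ideal.axioms(1)[OF ideal_I]] by (simp add: free_algebra_ops)

lemma I_lmult: "f \<in> I \<Longrightarrow> g \<in> carrier A \<Longrightarrow> g * f \<in> I"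
  using ideal.I_l_closed[OF ideal_I] by (simp add: free_algebra_ops)

lemma I_rmult: "f \<in> I \<Longrightarrow> g \<in> carrier A \<Longrightarrow> f * g \<in> I"
  using ideal.I_r_closed[OF ideal_I] by (simp add: free_algebra_ops)

lemma I_sum: "(\<And>a. a \<in> S \<Longrightarrow> f a \<in> I) \<Longrightarrow> sum f S \<in> I"
  by (induction S rule: infinite_finite_induct) (auto simp: I_zero I_add)

lemma I_uminus: 
  assumes "f \<in> I" shows "- f \<in> I"
proof -
  have "Poly_Mapping.single [] (- 1) * f \<in> I"
    using assms by (intro I_lmult single_in_free_algebra) auto
  also have "Poly_Mapping.single [] (- 1) = (- 1 :: 'x list \<Rightarrow>\<^sub>0 'f)"
    unfolding single_uminus by (metis single_one zero_list_def)
  finally show ?thesis by simp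
qed

lemma I_diff: "f \<in> I \<Longrightarrow> g \<in> I \<Longrightarrow> f - g \<in> I"
  using I_add[of f "- g"] I_uminus by simp

lemma cls_eq_iff:
  "f \<in> carrier A \<Longrightarrow> g \<in> carrier A \<Longrightarrow> cls f = cls g \<longleftrightarrow> f - g \<in> I"
  unfolding cls_def
  using ring.quotient_eq_iff_same_a_r_cos[OF ring_free_algebra ideal_I] by (simp add: minus_free_algebra)


subsection \<open>Independence of the words of different independent sets\<close>

lemma set_coeff_relation:
  assumes "r \<in> R" "indep S"
  shows "set_coeff S r = 0"
proof -
  obtain a b where ab: "a \<in> X" "b \<in> X"
    "if conf a b then r = word [a, b] else r = word [a, b] - word [b, a]"
    using relation_cases assms(1) by meson
  show ?thesis
  proof (cases "conf a b")
    case True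
    then show ?thesis using ab assms(2) by (auto simp: set_coeff_single indep_def)
  next
    case False
    then show ?thesis using ab by (auto simp: set_coeff_diff set_coeff_single)
  qed
qed

text \<open>
  The common kernel of the functionals for all independent sets is an ideal because multiplication by a
  word turns the functional of \<open>S\<close> into that of a subset of \<open>S\<close>, which is again independent.
  The kernel of a single functional is not an ideal in general, so all of them are treated at once.
\<close>

lemma set_coeff_ideal:
  assumes "f \<in> I" "indep S"
  shows "set_coeff S f = 0"
proof -
  define J where "J = {f \<in> carrier A. \<forall>S. indep S \<longrightarrow> set_coeff S f = 0}"
  interpret A: ring A by (rule ring_free_algebra)
  have indep_Diff: "indep (S - T)" if "indep S" for S T
    using that by (auto simp: indep_def)
  have "ideal J A"
  proof (rule idealI[OF ring_free_algebra])
    show "subgroup J (add_monoid A)"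
    proof (rule A.add.subgroupI)
      show "J \<subseteq> carrier A" by (auto simp: J_def)
      have "0 \<in> J" by (simp add: J_def carrier_free_algebra)
      then show "J \<noteq> {}" by blast
    next
      fix f assume f: "f \<in> J"
      then have "\<ominus>\<^bsub>A\<^esub> f = 0 \<ominus>\<^bsub>A\<^esub> f"
        using A.minus_eq[of "\<zero>\<^bsub>A\<^esub>" f] by (simp add: J_def free_algebra_ops)
      also have "\<dots> = 0 - f"
        using f by (intro minus_free_algebra) (auto simp: J_def carrier_free_algebra)
      finally show "\<ominus>\<^bsub>A\<^esub> f \<in> J"
        using f set_coeff_diff[of _ 0 f] by (simp add: J_def carrier_free_algebra)
    next
      fix f g assume "f \<in> J" "g \<in> J"
      then show "f \<oplus>\<^bsub>A\<^esub> g \<in> J"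
        using A.a_closed[of f g] by (auto simp: J_def free_algebra_ops set_coeff_add)
    qed
  next
    fix f g assume f: "f \<in> J" and g: "g \<in> carrier A"
    have "set_coeff S ((\<Sum>w\<in>Poly_Mapping.keys g. Poly_Mapping.single w (Poly_Mapping.lookup g w)) * f) = 0"
      if "indep S" for S
      using f that indep_Diff by (auto simp: J_def sum_distrib_right set_coeff_sum set_coeff_single_mult intro!: sum.neutral)
    then show "g \<otimes>\<^bsub>A\<^esub> f \<in> J"
      using f g A.m_closed[of g f] by (auto simp: J_def free_algebra_ops sum_single_lookup)
    have "set_coeff S (f * (\<Sum>w\<in>Poly_Mapping.keys g. Poly_Mapping.single w (Poly_Mapping.lookup g w))) = 0"
      if "indep S" for S
      using f that indep_Diff by (auto simp: J_def sum_distrib_left set_coeff_sum set_coeff_mult_single intro!: sum.neutral)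
    then show "f \<otimes>\<^bsub>A\<^esub> g \<in> J"
      using f g A.m_closed[of f g] by (auto simp: J_def free_algebra_ops sum_single_lookup)
  qed
  moreover have "R \<subseteq> J"
    using relations_in_carrier set_coeff_relation by (auto simp: J_def)
  ultimately have "I \<subseteq> J"
    unfolding I_def by (rule A.genideal_minimal)
  then show ?thesis using assms by (auto simp: J_def)
qed


subsection \<open>Reduction of words modulo the relations\<close>

lemma word_in_carrier: "set w \<subseteq> X \<Longrightarrow> word w \<in> carrier A"
  by (rule single_in_free_algebra)

lemma conflict_in_I: "a \<in> X \<Longrightarrow> b \<in> X \<Longrightarrow> conf a b \<Longrightarrow> word [a, b] \<in> I"
  using conflict_relation R_subset_I by blast

lemma commute_in_I: 
  assumes "a \<in> X" "b \<in> X" "\<not> conf a b" 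
  shows "word [a, b] - word [b, a] \<in> I"
proof -
  have "word [a, b] - word [b, a] \<in> I \<or> - (word [a, b] - word [b, a]) \<in> I"
    using commuting_relation[OF assms] R_subset_I by auto
  then show ?thesis using I_uminus by fastforce
qed

lemma move_to_front:
  assumes "set u \<subseteq> X" "a \<in> X" "\<And>b. b \<in> set u \<Longrightarrow> \<not> conf b a"
  shows "word (u @ [a]) - word (a # u) \<in> I"
  using assms
proof (induction u)
  case Nil
  then show ?case by (simp add: I_zero)
next
  case (Cons b u)
  have "word [b] * (word (u @ [a]) - word (a # u)) \<in> I"
    using Cons by (intro I_lmult word_in_carrier) auto
  moreover have "(word [b, a] - word [a, b]) * word u \<in> I"
    using Cons.prems by (intro I_rmult commute_in_I word_in_carrier) auto
  ultimately have "word [b] * (word (u @ [a]) - word (a # u)) +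
      (word [b, a] - word [a, b]) * word u \<in> I"
    by (rule I_add)
  then show ?case
    by (simp add: algebra_simps single_mult_single_words)
qed

text \<open>
  If the word behind the first letter \<open>a\<close> already vanishes, so does the whole word. Otherwise the first
  later letter that conflicts with \<open>a\<close> commutes with everything between them, because those letters
  belong to an independent set together with it; hence it can be moved next to \<open>a\<close>, where the product is zero.
\<close>

lemma word_in_I:
  assumes "set w \<subseteq> X" "\<not> (distinct w \<and> indep (set w))"
  shows "word w \<in> I"
  using assms
proof (induction w)
  case Nil
  then show ?case by (simp add: indep_def)
next
  case (Cons a w)
  show ?case
  proof (cases "distinct w \<and> indep (set w)")
    case False
    then have "word [a] * word w \<in> I"
      using Cons by (intro I_lmult word_in_carrier) auto
    then show ?thesis by (simp add: single_mult_single_words)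
  next
    case True
    have "\<exists>b\<in>set w. conf a b"
    proof (rule ccontr)
      assume none: "\<not> (\<exists>b\<in>set w. conf a b)"
      have X: "a \<in> X" "set w \<subseteq> X" using Cons.prems by auto
      then have "a \<notin> set w" using none conf_refl by blast
      moreover have "\<not> conf b a" if "b \<in> set w" for b
        using none conf_sym X that by blast
      then have "indep (set (a # w))"
        using True X none unfolding indep_def by auto
      ultimately show False using True Cons.prems by auto
    qed
    from split_list_first_prop[OF this]
    obtain u b v where w: "w = u @ b # v" "conf a b" "\<And>c. c \<in> set u \<Longrightarrow> \<not> conf a c"
      by blast
    have X: "a \<in> X" "b \<in> X" "set u \<subseteq> X" "set v \<subseteq> X"
      using Cons.prems w by auto
    have "\<not> conf c b" if "c \<in> set u" for c
      using that w True unfolding indep_def by auto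
    then have "word (u @ [b]) - word (b # u) \<in> I"
      using X by (intro move_to_front) auto
    then have "word [a] * (word (u @ [b]) - word (b # u)) * word v \<in> I"
      using X by (intro I_rmult I_lmult word_in_carrier) auto
    moreover have "word [a, b] * word (u @ v) \<in> I"
      using X w by (intro I_rmult conflict_in_I word_in_carrier) auto
    ultimately have "word [a] * (word (u @ [b]) - word (b # u)) * word v + word [a, b] * word (u @ v) \<in> I"
      by (rule I_add)
    then show ?thesis
      by (simp add: w algebra_simps single_mult_single_words)
  qed
qed

text \<open>The first letter of \<open>w\<close> can be moved to the front of \<open>w'\<close>; the remainders agree by induction.\<close>

lemma words_of_same_set:
  assumes "set w \<subseteq> X" "distinct w" "indep (set w)" "distinct w'" "set w' = set w"
  shows "word w - word w' \<in> I"
  using assms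
proof (induction w arbitrary: w')
  case Nil
  then show ?case by (simp add: I_zero)
next
  case (Cons a w)
  then obtain u v where w': "w' = u @ a # v"
    by (metis list.set_intros(1) split_list)
  have X: "a \<in> X" "set u \<subseteq> X" "set v \<subseteq> X"
    using Cons.prems w' unfolding indep_def by auto
  have "set (u @ v) = set w"
    using Cons.prems w' by auto
  then have "word w - word (u @ v) \<in> I"
    using Cons.prems w' by (intro Cons.IH) (auto simp: indep_def)
  then have 1: "word [a] * (word w - word (u @ v)) \<in> I"
    using X by (intro I_lmult word_in_carrier) auto
  have "\<not> conf b a" if "b \<in> set u" for b
    using that Cons.prems w' unfolding indep_def by auto
  then have "(word (u @ [a]) - word (a # u)) * word v \<in> I"
    using X by (intro I_rmult move_to_front word_in_carrier) auto
  from I_diff[OF 1 this] show ?case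
    by (simp add: w' algebra_simps single_mult_single_words)
qed


subsection \<open>The basis of normal words\<close>

definition normal_word :: "'x set \<Rightarrow> 'x list" where
  "normal_word S = (SOME w. distinct w \<and> set w = S)"

lemma normal_word:
  assumes "indep S"
  shows "distinct (normal_word S)" "set (normal_word S) = S" "set (normal_word S) \<subseteq> X"
    "length (normal_word S) = card S"
proof -
  have "finite S"
    using assms finite_letters by (auto simp: indep_def intro: finite_subset)
  then have *: "distinct (normal_word S) \<and> set (normal_word S) = S"
    unfolding normal_word_def using finite_distinct_list by (metis (mono_tags, lifting) someI)
  then show "distinct (normal_word S)" "set (normal_word S) = S" by auto
  then show "set (normal_word S) \<subseteq> X" "length (normal_word S) = card S"
    using assms distinct_card by (fastforce simp: indep_def)+
qed

lemma single_reduction: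
  assumes "set w \<subseteq> X"
  shows "\<exists>g. Poly_Mapping.single w a - g \<in> I \<and>
    Poly_Mapping.keys g \<subseteq> normal_word ` {S. indep S \<and> card S = length w}"
proof (cases "distinct w \<and> indep (set w)")
  case True
  let ?v = "normal_word (set w)"
  have "Poly_Mapping.single [] a * (word w - word ?v) \<in> I"
    using assms True normal_word[of "set w"]
    by (intro I_lmult words_of_same_set single_in_free_algebra) auto
  then have "Poly_Mapping.single w a - Poly_Mapping.single ?v a \<in> I"
    by (simp add: algebra_simps single_mult_single_words)
  moreover have "Poly_Mapping.keys (Poly_Mapping.single ?v a) \<subseteq> 
      normal_word ` {S. indep S \<and> card S = length w}"
    using True by (auto simp: distinct_card)
  ultimately show ?thesis by blast
next
  case False
  have "Poly_Mapping.single [] a * word w \<in> I"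
    using assms False by (intro I_lmult word_in_I single_in_free_algebra) auto
  then show ?thesis
    by (intro exI[of _ 0]) (simp_all add: single_mult_single_words)
qed

lemma homogeneous_reduction:
  assumes "f \<in> carrier A" "\<And>w. w \<in> Poly_Mapping.keys f \<Longrightarrow> length w = d"
  obtains g where "f - g \<in> I" "Poly_Mapping.keys g \<subseteq> normal_word ` {S. indep S \<and> card S = d}"
proof -
  let ?N = "normal_word ` {S. indep S \<and> card S = d}"
  have "\<forall>w\<in>Poly_Mapping.keys f. \<exists>g.
      Poly_Mapping.single w (Poly_Mapping.lookup f w) - g \<in> I \<and> Poly_Mapping.keys g \<subseteq> ?N"
  proof
    fix w assume w: "w \<in> Poly_Mapping.keys f"
    then have "set w \<subseteq> X"
      using assms(1) unfolding carrier_free_algebra by blast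
    from single_reduction[OF this, of "Poly_Mapping.lookup f w"]
    show "\<exists>g. Poly_Mapping.single w (Poly_Mapping.lookup f w) - g \<in> I \<and> Poly_Mapping.keys g \<subseteq> ?N"
      unfolding assms(2)[OF w] .
  qed
  from bchoice[OF this] obtain g where g: "\<And>w. w \<in> Poly_Mapping.keys f \<Longrightarrow>
      Poly_Mapping.single w (Poly_Mapping.lookup f w) - g w \<in> I \<and> Poly_Mapping.keys (g w) \<subseteq> ?N"
    by blast
  show ?thesis
  proof
    have "(\<Sum>w\<in>Poly_Mapping.keys f. Poly_Mapping.single w (Poly_Mapping.lookup f w) - g w) \<in> I"
      using g by (intro I_sum) auto
    then show "f - (\<Sum>w\<in>Poly_Mapping.keys f. g w) \<in> I"
      by (simp add: sum_subtractf sum_single_lookup)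
    show "Poly_Mapping.keys (\<Sum>w\<in>Poly_Mapping.keys f. g w) \<subseteq> ?N"
      using keys_sum[of g "Poly_Mapping.keys f"] g by blast
  qed
qed

text \<open>
  Together with the next lemmas, this replaces a component of the quotient by the image of the span of an
  explicit set of normal words, for which the dimension can be found one word at a time.
\<close>

lemma component_eq_normal:
  "cls ` {f \<in> carrier A. \<forall>w\<in>Poly_Mapping.keys f. length w = d} =
   cls ` {f. Poly_Mapping.keys f \<subseteq> normal_word ` {S. indep S \<and> card S = d}}" (is "?L = ?R")
proof
  have normal: "g \<in> carrier A" 
    if "Poly_Mapping.keys g \<subseteq> normal_word ` {S. indep S \<and> card S = d}" for g :: "'x list \<Rightarrow>\<^sub>0 'f"
    using that normal_word(3) unfolding carrier_free_algebra by blast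
  show "?L \<subseteq> ?R"
  proof
    fix u assume "u \<in> ?L"
    then obtain f where f: "f \<in> carrier A" "\<forall>w\<in>Poly_Mapping.keys f. length w = d" "u = cls f"
      by blast
    have "\<And>w. w \<in> Poly_Mapping.keys f \<Longrightarrow> length w = d"
      using f by blast
    from homogeneous_reduction[OF f(1) this]
    obtain g where g: "f - g \<in> I"
      "Poly_Mapping.keys g \<subseteq> normal_word ` {S. indep S \<and> card S = d}"
      by blast
    then have "cls f = cls g"
      using cls_eq_iff[OF f(1) normal[OF g(2)]] by simp
    then show "u \<in> ?R"
      using f(3) g(2) by blast
  qed
  show "?R \<subseteq> ?L"
  proof (intro image_mono subsetI CollectI conjI ballI)
    fix g :: "'x list \<Rightarrow>\<^sub>0 'f"
    assume "g \<in> {f. Poly_Mapping.keys f \<subseteq> normal_word ` {S. indep S \<and> card S = d}}"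
    then have g: "Poly_Mapping.keys g \<subseteq> normal_word ` {S. indep S \<and> card S = d}" by simp
    then show "g \<in> carrier A" by (rule normal)
    fix w assume "w \<in> Poly_Mapping.keys g"
    then obtain S where "indep S" "card S = d" "w = normal_word S"
      using g by blast
    then show "length w = d"
      by (simp add: normal_word(4))
  qed
qed

lemma cls_hom: "ring_hom_ring A (A Quot I) cls"
  using ideal.rcos_ring_hom_ring[OF ideal_I] by (simp add: cls_def[abs_def])

lemma cls_zero_neq_one: "\<one>\<^bsub>A Quot I\<^esub> \<noteq> \<zero>\<^bsub>A Quot I\<^esub>"
proof
  interpret cls: ring_hom_ring A "A Quot I" cls by (rule cls_hom)
  assume "\<one>\<^bsub>A Quot I\<^esub> = \<zero>\<^bsub>A Quot I\<^esub>"
  then have "cls (word []) = cls 0"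
    using cls.hom_one cls.hom_zero by (metis free_algebra_ops(3,4) single_one zero_list_def)
  then have "word [] \<in> I"
    by (subst (asm) cls_eq_iff) (simp_all add: carrier_free_algebra)
  from set_coeff_ideal[OF this, of "{}"] show False
    by (simp add: indep_def set_coeff_single)
qed

text \<open>
  The constants form a field in the free algebra, and this survives in the quotient because the
  quotient is not the zero ring: the functional of the empty set separates \<open>1\<close> from the ideal.
\<close>

lemma subfield_scalars: "subfield scalars (A Quot I)"
proof -
  interpret cls: ring_hom_ring A "A Quot I" cls by (rule cls_hom)
  let ?K = "range (Poly_Mapping.single []) :: ('x list \<Rightarrow>\<^sub>0 'f) set"
  have one: "word [] = (1 :: 'x list \<Rightarrow>\<^sub>0 'f)"
    by (metis single_one zero_list_def)
  have K_carrier: "?K \<subseteq> carrier A"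
    by (auto intro: single_in_free_algebra)
  have "subfield ?K A"
  proof (rule cls.R.subfieldI)
    show "subcring ?K A"
    proof (rule cls.R.subcringI[OF cls.R.subringI[OF K_carrier]])
      show "\<one>\<^bsub>A\<^esub> \<in> ?K"
        by (metis free_algebra_ops(3) one rangeI)
      fix h assume "h \<in> ?K"
      then obtain c where c: "h = Poly_Mapping.single [] c" by blast
      have "\<ominus>\<^bsub>A\<^esub> h = Poly_Mapping.single [] (- c)"
        by (rule cls.R.minus_equality)
           (simp_all add: c free_algebra_ops single_in_free_algebra flip: single_add)
      then show "\<ominus>\<^bsub>A\<^esub> h \<in> ?K" by simp
    qed (auto simp: free_algebra_ops single_mult_single_words mult.commute simp flip: single_add)
    show "Units (A\<lparr>carrier := ?K\<rparr>) = ?K - {\<zero>\<^bsub>A\<^esub>}"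
    proof (intro equalityI subsetI)
      fix h assume "h \<in> ?K - {\<zero>\<^bsub>A\<^esub>}"
      then obtain c where c: "h = Poly_Mapping.single [] c" "c \<noteq> 0"
        by (metis Diff_iff free_algebra_ops(4) image_iff singleton_iff single_zero)
      then show "h \<in> Units (A\<lparr>carrier := ?K\<rparr>)"
        by (auto simp: Units_def free_algebra_ops single_mult_single_words one
                 intro!: exI[of _ "inverse c"])
    next
      fix h assume "h \<in> Units (A\<lparr>carrier := ?K\<rparr>)"
      then show "h \<in> ?K - {\<zero>\<^bsub>A\<^esub>}"
        by (auto simp: Units_def free_algebra_ops)
    qed
  qed
  from cls.img_is_subfield(2)[OF this cls_zero_neq_one]
  show ?thesis by (simp add: scalars_def image_image)
qed

text \<open>
  Each further normal word enlarges the span by one dimension: the functional of its set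
  vanishes on the ideal and on the normal words of all other sets, but not on this word.
\<close>

lemma dimension_normal:
  assumes "finite B" "\<And>S. S \<in> B \<Longrightarrow> indep S"
  shows "ring.dimension (A Quot I) (card B) scalars 
           (cls ` {f. Poly_Mapping.keys f \<subseteq> normal_word ` B})"
  using assms
proof (induction B)
  case empty
  interpret cls: ring_hom_ring A "A Quot I" cls by (rule cls_hom)
  have "cls ` {f. Poly_Mapping.keys f \<subseteq> normal_word ` {}} = {\<zero>\<^bsub>A Quot I\<^esub>}"
    using cls.hom_zero by (simp add: free_algebra_ops)
  then show ?case using cls.S.dimension.zero_dim by simp
next
  case (insert S B)
  interpret cls: ring_hom_ring A "A Quot I" cls by (rule cls_hom)
  let ?E = "\<lambda>B. cls ` {f. Poly_Mapping.keys f \<subseteq> normal_word ` B}"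
  define w where "w = normal_word S"
  have w: "distinct w" "set w = S" "set w \<subseteq> X" and w_carrier: "word w \<in> carrier A"
    using normal_word[of S] insert.prems by (auto simp: w_def word_in_carrier)
  have B_carrier: "f \<in> carrier A" if "Poly_Mapping.keys f \<subseteq> normal_word ` B" 
    for f :: "'x list \<Rightarrow>\<^sub>0 'f"
    using that normal_word(3) insert.prems unfolding carrier_free_algebra by blast
  have notin: "cls (word w) \<notin> ?E B"
  proof
    assume "cls (word w) \<in> ?E B"
    then obtain f where f: "Poly_Mapping.keys f \<subseteq> normal_word ` B" "cls (word w) = cls f"
      by auto
    then have "word w - f \<in> I"
      using cls_eq_iff w_carrier B_carrier by blast
    then have "set_coeff S (word w - f) = 0"
      using insert.prems by (intro set_coeff_ideal) auto
    then have "set_coeff S (word w) = set_coeff S f"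
      by (simp add: set_coeff_diff)
    also have "set_coeff S f = 0"
    proof (rule set_coeff_eq_zero)
      fix v assume "v \<in> Poly_Mapping.keys f"
      then obtain T where T: "T \<in> B" "v = normal_word T"
        using f by blast
      then have "set v = T"
        using insert.prems by (simp add: normal_word(2))
      then show "set v \<noteq> S"
        using T insert.hyps by auto
    qed
    finally show False
      using w by (simp add: set_coeff_single)
  qed
  have cls_line: "cls (Poly_Mapping.single [] c) \<otimes>\<^bsub>A Quot I\<^esub> cls (word w) \<oplus>\<^bsub>A Quot I\<^esub> cls f =
      cls (Poly_Mapping.single w c + f)" if "Poly_Mapping.keys f \<subseteq> normal_word ` B" for c f
  proof -
    have "cls (Poly_Mapping.single [] c) \<otimes>\<^bsub>A Quot I\<^esub> cls (word w) = cls (Poly_Mapping.single w c)"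
      using cls.hom_mult[OF single_in_free_algebra w_carrier, of "[]" c]
      by (simp add: free_algebra_ops single_mult_single_words)
    then show ?thesis
      using cls.hom_add[OF single_in_free_algebra[OF w(3)] B_carrier[OF that]] 
      by (simp add: free_algebra_ops)
  qed
  have "cls.S.line_extension scalars (cls (word w)) (?E B) = ?E (insert S B)"
  proof (intro equalityI subsetI)
    fix u assume "u \<in> cls.S.line_extension scalars (cls (word w)) (?E B)"
    then obtain c f where f: "Poly_Mapping.keys f \<subseteq> normal_word ` B" 
      and "u = cls (Poly_Mapping.single w c + f)"
      unfolding cls.S.line_extension_mem_iff scalars_def using cls_line by auto
    moreover have "Poly_Mapping.keys (Poly_Mapping.single w c + f) \<subseteq> normal_word ` insert S B"
      using f Poly_Mapping.keys_add[of "Poly_Mapping.single w c" f] 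
      by (auto simp: w_def split: if_splits)
    ultimately show "u \<in> ?E (insert S B)" by blast
  next
    fix u assume "u \<in> ?E (insert S B)"
    then obtain f where f: "Poly_Mapping.keys f \<subseteq> insert w (normal_word ` B)" "u = cls f"
      by (auto simp: w_def)
    define g where "g = f - Poly_Mapping.single w (Poly_Mapping.lookup f w)"
    have g: "Poly_Mapping.keys g \<subseteq> normal_word ` B"
    proof
      fix v assume v: "v \<in> Poly_Mapping.keys g"
      then have "v \<noteq> w" by (auto simp: g_def in_keys_iff lookup_minus)
      then have "v \<in> Poly_Mapping.keys f"
        using v by (auto simp: g_def in_keys_iff lookup_minus lookup_single)
      with f \<open>v \<noteq> w\<close> show "v \<in> normal_word ` B" by blast
    qed
    have "u = cls (Poly_Mapping.single w (Poly_Mapping.lookup f w) + g)"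
      by (simp add: f g_def)
    then show "u \<in> cls.S.line_extension scalars (cls (word w)) (?E B)"
      unfolding cls.S.line_extension_mem_iff scalars_def using cls_line[OF g] g by blast
  qed
  moreover have "cls.S.dimension (Suc (card B)) scalars
      (cls.S.line_extension scalars (cls (word w)) (?E B))"
    using insert.IH insert.prems notin w_carrier by (intro cls.S.dimension.Suc_dim) auto
  ultimately show ?case using insert.hyps by simp
qed

theorem dimension_component:
  "ring.dimension (A Quot I) (card {S. indep S \<and> card S = d}) scalars 
     (cls ` {f \<in> carrier A. \<forall>w\<in>Poly_Mapping.keys f. length w = d})"
proof -
  have "finite {S. indep S \<and> card S = d}"
    using finite_letters by (auto simp: indep_def intro: finite_subset[of _ "Pow X"])
  then show ?thesis
    unfolding component_eq_normal by (intro dimension_normal) auto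
qed

end


section \<open>Matchings of the cycle\<close>

text \<open>
  These are the matchings with \<open>d\<close> edges of a path whose \<open>m\<close> consecutive edges are numbered from \<open>a\<close>.
\<close>

definition sparse_sets :: "nat \<Rightarrow> nat \<Rightarrow> nat \<Rightarrow> nat set set" where
  "sparse_sets a m d = {S. S \<subseteq> {a..<a + m} \<and> card S = d \<and> (\<forall>i\<in>S. Suc i \<notin> S)}"

lemma finite_sparse_sets: "finite (sparse_sets a m d)"
  by (rule finite_subset[of _ "Pow {a..<a + m}"]) (auto simp: sparse_sets_def)

lemma sparse_sets_0: "sparse_sets a m 0 = {{}}"
  by (auto simp: sparse_sets_def card_eq_0_iff dest: finite_subset)

text \<open>Splitting by whether the last number is used; if so, its predecessor is excluded.\<close>

lemma sparse_sets_rec: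
  "sparse_sets a (Suc (Suc m)) (Suc d) =
     sparse_sets a (Suc m) (Suc d) \<union> insert (Suc (a + m)) ` sparse_sets a m d" (is "?L = ?R \<union> insert ?x ` ?T")
proof (intro equalityI subsetI)
  fix S assume S: "S \<in> ?L"
  have fin: "finite S"
    using S by (auto simp: sparse_sets_def dest: finite_subset)
  show "S \<in> ?R \<union> insert ?x ` ?T"
  proof (cases "?x \<in> S")
    case True
    have "S - {?x} \<subseteq> {a..<a + m}"
    proof
      fix i assume i: "i \<in> S - {?x}"
      then have "i \<noteq> a + m"
        using S True by (auto simp: sparse_sets_def)
      moreover have "a \<le> i" "i < a + Suc (Suc m)"
        using S i by (auto simp: sparse_sets_def)
      ultimately show "i \<in> {a..<a + m}" using i by auto
    qed
    then have "S - {?x} \<in> ?T"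
      using S fin True by (auto simp: sparse_sets_def)
    moreover have "S = insert ?x (S - {?x})"
      using True by auto
    ultimately show ?thesis by blast
  next
    case False
    have "S \<subseteq> {a..<a + Suc m}"
    proof
      fix i assume i: "i \<in> S"
      then have "i \<noteq> ?x" using False by auto
      moreover have "a \<le> i" "i < a + Suc (Suc m)"
        using S i by (auto simp: sparse_sets_def)
      ultimately show "i \<in> {a..<a + Suc m}" by auto
    qed
    then show ?thesis using S by (auto simp: sparse_sets_def)
  qed
next
  fix S assume "S \<in> ?R \<union> insert ?x ` ?T"
  then show "S \<in> ?L"
  proof
    assume "S \<in> ?R"
    then show ?thesis by (auto simp: sparse_sets_def)
  next
    assume "S \<in> insert ?x ` ?T"
    then obtain T where T: "S = insert ?x T" "T \<in> ?T" by blast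
    then have "finite T" "?x \<notin> T" "Suc ?x \<notin> T" "\<forall>i\<in>T. Suc i \<noteq> ?x"
      by (auto simp: sparse_sets_def dest: finite_subset)
    then show ?thesis
      using T by (auto simp: sparse_sets_def)
  qed
qed

lemma card_insert_sparse_sets:
  assumes "x \<notin> {a..<a + m}"
  shows "card (insert x ` sparse_sets a m d) = card (sparse_sets a m d)"
proof (intro card_image inj_onI)
  fix S T assume "S \<in> sparse_sets a m d" "T \<in> sparse_sets a m d" "insert x S = insert x T"
  moreover from this have "x \<notin> S" "x \<notin> T"
    using assms by (auto simp only: sparse_sets_def)
  ultimately show "S = T"
    by (simp add: insert_ident)
qed

text \<open>
  The recursion is Pascal's rule. The truncated subtraction is harmless: for \<open>d > Suc m\<close> the binomial
  coefficient is \<open>0 choose d\<close>, which is \<open>0\<close>.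
\<close>

lemma card_sparse_sets: "card (sparse_sets a m d) = (Suc m - d) choose d"
proof (induction m arbitrary: d rule: induct_nat_012)
  case 0
  then show ?case
    by (cases d) (auto simp: sparse_sets_0, auto simp: sparse_sets_def)
next
  case 1
  have "sparse_sets a (Suc 0) (Suc d) = (if d = 0 then {{a}} else {})" for d
  proof -
    have "S \<subseteq> {a..<a + Suc 0} \<longleftrightarrow> S = {} \<or> S = {a}" for S
      by (simp add: atLeastLessThanSuc subset_singleton_iff)
    then have "S \<in> sparse_sets a (Suc 0) (Suc d) \<longleftrightarrow> S = {a} \<and> d = 0" for S
      unfolding sparse_sets_def mem_Collect_eq by fastforce
    then show ?thesis by (cases "d = 0") (simp_all add: set_eq_iff)
  qed
  then show ?case
    by (cases d) (simp_all add: sparse_sets_0)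
next
  case (ge2 m)
  show ?case
  proof (cases d)
    case 0
    then show ?thesis by (simp add: sparse_sets_0)
  next
    case (Suc k)
    have "card (sparse_sets a (Suc (Suc m)) (Suc k)) =
        card (sparse_sets a (Suc m) (Suc k)) + card (insert (Suc (a + m)) ` sparse_sets a m k)"
      unfolding sparse_sets_rec
      by (intro card_Un_disjoint finite_imageI finite_sparse_sets) (auto simp: sparse_sets_def)
    also have "\<dots> = (Suc (Suc m) - Suc k choose Suc k) + (Suc m - k choose k)"
      using ge2 by (simp add: card_insert_sparse_sets)
    also have "\<dots> = (Suc (Suc (Suc m)) - Suc k choose Suc k)"
      by (cases "k \<le> Suc m") (auto simp: Suc_diff_le)
    finally show ?thesis using Suc by simp
  qed
qed

definition cyclic_sparse_sets :: "nat \<Rightarrow> nat \<Rightarrow> nat set set" where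
  "cyclic_sparse_sets n d =
     {S. S \<subseteq> {1..n} \<and> card S = d \<and> (\<forall>i\<in>S. Suc i \<notin> S) \<and> \<not> (1 \<in> S \<and> n \<in> S)}"

lemma cyclic_sparse_sets_0: "cyclic_sparse_sets n 0 = {{}}"
  by (auto simp: cyclic_sparse_sets_def card_eq_0_iff dest: finite_subset)

text \<open>
  Cutting the cycle at the edge \<open>n\<close>: without it, a path of \<open>n - 1\<close> edges is left; with it, the neighbours
  \<open>1\<close> and \<open>n - 1\<close> are excluded as well and a path of \<open>n - 3\<close> edges is left.
\<close>

lemma cyclic_sparse_sets_rec:
  assumes "n > 3"
  shows "cyclic_sparse_sets n (Suc d) =
     sparse_sets 1 (n - 1) (Suc d) \<union> insert n ` sparse_sets 2 (n - 3) d" (is "?L = ?R \<union> insert n ` ?T")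
proof (intro equalityI subsetI)
  fix S assume S: "S \<in> ?L"
  have fin: "finite S"
    using S by (auto simp: cyclic_sparse_sets_def dest: finite_subset)
  show "S \<in> ?R \<union> insert n ` ?T"
  proof (cases "n \<in> S")
    case True
    have "S - {n} \<subseteq> {2..<2 + (n - 3)}"
    proof
      fix i assume i: "i \<in> S - {n}"
      then have "i \<noteq> 1" "Suc i \<noteq> n"
        using S True by (auto simp: cyclic_sparse_sets_def)
      moreover have "1 \<le> i" "i \<le> n"
        using S i by (auto simp: cyclic_sparse_sets_def)
      ultimately show "i \<in> {2..<2 + (n - 3)}" using i assms by auto
    qed
    then have "S - {n} \<in> ?T"
      using S fin True by (auto simp: sparse_sets_def cyclic_sparse_sets_def)
    moreover have "S = insert n (S - {n})"
      using True by auto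
    ultimately show ?thesis by blast
  next
    case False
    have "S \<subseteq> {1..<1 + (n - 1)}"
    proof
      fix i assume i: "i \<in> S"
      then have "i \<noteq> n" using False by auto
      moreover have "1 \<le> i" "i \<le> n"
        using S i by (auto simp: cyclic_sparse_sets_def)
      ultimately show "i \<in> {1..<1 + (n - 1)}" by auto
    qed
    then show ?thesis using S by (auto simp: sparse_sets_def cyclic_sparse_sets_def)
  qed
next
  fix S assume "S \<in> ?R \<union> insert n ` ?T"
  then show "S \<in> ?L"
  proof
    assume S: "S \<in> ?R"
    then have "S \<subseteq> {1..n}" "n \<notin> S"
      by (auto simp: sparse_sets_def subset_iff)
    then show ?thesis using S by (auto simp: sparse_sets_def cyclic_sparse_sets_def)
  next
    assume "S \<in> insert n ` ?T"
    then obtain T where T: "S = insert n T" "T \<in> ?T" by blast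
    then have "finite T" "T \<subseteq> {2..<2 + (n - 3)}"
      by (auto simp: sparse_sets_def dest: finite_subset)
    then have "n \<notin> T" "Suc n \<notin> T" "1 \<notin> T" "T \<subseteq> {1..n}" "\<forall>i\<in>T. Suc i \<noteq> n"
      using assms by (auto simp: subset_iff)
    then show ?thesis
      using T assms \<open>finite T\<close> by (auto simp: sparse_sets_def cyclic_sparse_sets_def)
  qed
qed

lemma card_cyclic_sparse_sets:
  assumes "n > 3"
  shows "card (cyclic_sparse_sets n (Suc d)) = (n - Suc d choose Suc d) + (n - Suc d - 1 choose d)"
proof -
  have n: "Suc (n - 1) = n" "Suc (n - 3) - d = n - Suc d - 1"
    using assms by auto
  have "card (cyclic_sparse_sets n (Suc d)) =
      card (sparse_sets 1 (n - 1) (Suc d)) + card (insert n ` sparse_sets 2 (n - 3) d)"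
    unfolding cyclic_sparse_sets_rec[OF assms]
    by (intro card_Un_disjoint finite_imageI finite_sparse_sets) (use assms in \<open>auto simp: sparse_sets_def\<close>)
  also have "card (insert n ` sparse_sets 2 (n - 3) d) = card (sparse_sets 2 (n - 3) d)"
    using assms by (intro card_insert_sparse_sets) auto
  finally show ?thesis
    unfolding card_sparse_sets n .
qed

lemma card_cyclic_sparse_sets_lucas:
  assumes "n > 3"
  shows "(of_nat (card (cyclic_sparse_sets n d)) :: rat) =
    (if d \<le> n div 2 then of_nat n / of_nat (n - d) * of_nat ((n - d) choose d) else 0)"
proof (cases d)
  case 0
  then show ?thesis using assms by (simp add: cyclic_sparse_sets_0)
next
  case (Suc k)
  show ?thesis
  proof (cases "d \<le> n div 2")
    case True
    define m where "m = n - Suc d"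
    have m: "n - d = Suc m" "n = Suc m + Suc k"
      using True assms Suc by (auto simp: m_def)
    \<comment> \<open>The absorption identity turns the second summand of the count into a multiple of the first.\<close>
    let ?C = "of_nat (Suc m choose Suc k) :: rat"
    have "of_nat (Suc m * (m choose k)) = (of_nat ((Suc m choose Suc k) * Suc k) :: rat)"
      by (simp only: Suc_times_binomial_eq)
    then have *: "of_nat (Suc m) * of_nat (m choose k) = ?C * of_nat (Suc k)"
      by (simp only: of_nat_mult)
    have "of_nat n * ?C = of_nat (Suc m) * ?C + ?C * of_nat (Suc k)"
      by (simp add: m(2) algebra_simps)
    also have "\<dots> = of_nat (Suc m) * (?C + of_nat (m choose k))"
      unfolding *[symmetric] by (simp only: distrib_left)
    finally have "of_nat n / of_nat (Suc m) * ?C = ?C + of_nat (m choose k)"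
      by (simp del: of_nat_Suc binomial_Suc_Suc add: field_simps)
    moreover have "card (cyclic_sparse_sets n d) = (Suc m choose Suc k) + (m choose k)"
      using card_cyclic_sparse_sets[OF assms, of k] m Suc by simp
    ultimately show ?thesis
      using True m(1) Suc by (simp del: binomial_Suc_Suc)
  next
    case False
    then have "n - Suc k < Suc k" "n - Suc k - 1 < k"
      using Suc assms by auto
    then show ?thesis
      using False card_cyclic_sparse_sets[OF assms, of k] Suc by (simp add: binomial_eq_0)
  qed
qed

text \<open>
  The edge between \<open>n\<close> and \<open>1\<close> gets the number \<open>n\<close>, so that edges meet exactly if their numbers are
  equal or cyclically adjacent.
\<close>

definition cycle_edge :: "nat \<Rightarrow> nat \<Rightarrow> nat \<times> nat" where
  "cycle_edge n i = (if i = n then (1, n) else (i, i + 1))"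

definition meets :: "nat \<times> nat \<Rightarrow> nat \<times> nat \<Rightarrow> bool" where
  "meets e f \<longleftrightarrow> {fst e, snd e} \<inter> {fst f, snd f} \<noteq> {}"

lemma cycle_edges_image: "n > 3 \<Longrightarrow> cycle_edges n = cycle_edge n ` {1..n}"
  by (fastforce simp: cycle_edges_def cycle_edge_def image_iff)

lemma inj_cycle_edge: "n > 3 \<Longrightarrow> inj_on (cycle_edge n) {1..n}"
  by (auto simp: inj_on_def cycle_edge_def split: if_splits)

lemma meets_cycle_edge:
  assumes "n > 3" "i \<in> {1..n}" "j \<in> {1..n}"
  shows "meets (cycle_edge n i) (cycle_edge n j) \<longleftrightarrow>
    i = j \<or> j = Suc i \<or> i = Suc j \<or> i = 1 \<and> j = n \<or> i = n \<and> j = 1"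
  using assms by (auto simp: meets_def cycle_edge_def)

text \<open>The defining relations name the edges in several ways; here they are all brought to the numbering.\<close>

lemma gen_cycle_edge:
  assumes "n > 3"
  shows "m < n \<Longrightarrow> gen m (m + 1) = (word [cycle_edge n m] :: (nat \<times> nat) list \<Rightarrow>\<^sub>0 'f::field)"
    and "m + 1 < n \<Longrightarrow> gen (m + 1) (m + 2) = (word [cycle_edge n (m + 1)] :: _ \<Rightarrow>\<^sub>0 'f)"
    and "gen (n - 1) n = (word [cycle_edge n (n - 1)] :: _ \<Rightarrow>\<^sub>0 'f)"
    and "gen 1 2 = (word [cycle_edge n 1] :: _ \<Rightarrow>\<^sub>0 'f)"
    and "gen 1 n = (word [cycle_edge n n] :: _ \<Rightarrow>\<^sub>0 'f)"
  using assms by (auto simp: gen_def cycle_edge_def numeral_2_eq_2)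

lemma conflict_relation_fk:
  assumes n: "n > 3" and ij: "i \<in> {1..n}" "j \<in> {1..n}"
    and conflict: "i = j \<or> j = Suc i \<or> i = Suc j \<or> i = 1 \<and> j = n \<or> i = n \<and> j = 1"
  shows "word [cycle_edge n i, cycle_edge n j] \<in> (fk_relations n :: ((nat \<times> nat) list \<Rightarrow>\<^sub>0 'f::field) set)"
proof -
  let ?R = "fk_relations n :: ((nat \<times> nat) list \<Rightarrow>\<^sub>0 'f) set"
  let ?g = "\<lambda>i. word [cycle_edge n i]"
  note gen = gen_cycle_edge[OF n, where ?'f = 'f]
  have "?g i * ?g j \<in> ?R"
    using conflict
  proof (elim disjE conjE)
    assume "i = j"
    show ?thesis
    proof (cases "j = n")
      case True
      have "gen 1 n * gen 1 n \<in> ?R"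
        unfolding fk_relations_def by blast
      then show ?thesis using True \<open>i = j\<close> gen by simp
    next
      case False
      then have "gen j (j + 1) * gen j (j + 1) \<in> ?R"
        using ij unfolding fk_relations_def by fastforce
      then show ?thesis using False \<open>i = j\<close> gen(1)[of j] ij by simp
    qed
  next
    assume j: "j = Suc i"
    show ?thesis
    proof (cases "j = n")
      case True
      have "gen (n - 1) n * gen 1 n \<in> ?R"
        unfolding fk_relations_def by blast
      moreover have "n - 1 = i" using True j by simp
      ultimately show ?thesis using True gen(3,5) by simp
    next
      case False
      then have "gen i (i + 1) * gen (i + 1) (i + 2) \<in> ?R"
        using ij j unfolding fk_relations_def by fastforce
      then show ?thesis using False j gen(1)[of i] gen(2)[of i] ij by simp
    qed
  next
    assume i: "i = Suc j"
    show ?thesis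
    proof (cases "i = n")
      case True
      have "gen 1 n * gen (n - 1) n \<in> ?R"
        unfolding fk_relations_def by blast
      moreover have "n - 1 = j" using True i by simp
      ultimately show ?thesis using True gen(3,5) by simp
    next
      case False
      then have "gen (j + 1) (j + 2) * gen j (j + 1) \<in> ?R"
        using ij i unfolding fk_relations_def by fastforce
      then show ?thesis using False i gen(1)[of j] gen(2)[of j] ij by simp
    qed
  next
    assume *: "i = 1" "j = n"
    have "gen 1 2 * gen 1 n \<in> ?R"
      unfolding fk_relations_def by blast
    then show ?thesis using * gen by simp
  next
    assume *: "i = n" "j = 1"
    have "gen 1 n * gen 1 2 \<in> ?R"
      unfolding fk_relations_def by blast
    then show ?thesis using * gen by simp
  qed
  then show ?thesis by (simp add: single_mult_single_words)
qed

text \<open>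
  The pair \<open>1\<close>, \<open>n\<close> is excluded although its numbers are far apart: these edges share the vertex \<open>1\<close>.
\<close>

lemma commuting_relation_fk:
  assumes n: "n > 3" and ij: "1 \<le> i" "i + 2 \<le> j" "j \<le> n" "\<not> (i = 1 \<and> j = n)"
  shows "word [cycle_edge n i, cycle_edge n j] - word [cycle_edge n j, cycle_edge n i]
           \<in> (fk_relations n :: ((nat \<times> nat) list \<Rightarrow>\<^sub>0 'f::field) set)"
proof -
  let ?R = "fk_relations n :: ((nat \<times> nat) list \<Rightarrow>\<^sub>0 'f) set"
  note gen = gen_cycle_edge[OF n, where ?'f = 'f]
  have i: "gen i (i + 1) = (word [cycle_edge n i] :: _ \<Rightarrow>\<^sub>0 'f)"
    using gen(1)[of i] ij by simp
  show ?thesis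
  proof (cases "j = n")
    case True
    then have "2 \<le> i \<and> i \<le> n - 2" using ij by auto
    then have "gen i (i + 1) * gen 1 n - gen 1 n * gen i (i + 1) \<in> ?R"
      unfolding fk_relations_def by blast
    then show ?thesis
      unfolding i gen(5) True by (simp add: single_mult_single_words)
  next
    case False
    then have "1 \<le> i \<and> i \<le> j - 2 \<and> 3 \<le> j \<and> j \<le> n - 1" using ij by auto
    then have "gen i (i + 1) * gen j (j + 1) - gen j (j + 1) * gen i (i + 1) \<in> ?R"
      unfolding fk_relations_def by blast
    moreover have "gen j (j + 1) = (word [cycle_edge n j] :: _ \<Rightarrow>\<^sub>0 'f)"
      using gen(1)[of j] ij False by simp
    ultimately show ?thesis
      unfolding i by (simp add: single_mult_single_words)
  qed
qed

lemma fk_relation_cases: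
  fixes r :: "(nat \<times> nat) list \<Rightarrow>\<^sub>0 'f::field"
  assumes n: "n > 3" and r: "r \<in> fk_relations n"
  obtains i j where "i \<in> {1..n}" "j \<in> {1..n}" "r = word [cycle_edge n i, cycle_edge n j]"
      "i = j \<or> j = Suc i \<or> i = Suc j \<or> i = 1 \<and> j = n \<or> i = n \<and> j = 1"
  | i j where "1 \<le> i" "i + 2 \<le> j" "j \<le> n" "\<not> (i = 1 \<and> j = n)"
      "r = word [cycle_edge n i, cycle_edge n j] - word [cycle_edge n j, cycle_edge n i]"
proof -
  note gen = gen_cycle_edge[OF n, where ?'f = 'f]
  have word2: "word [a, b] = word [a] * (word [b] :: _ \<Rightarrow>\<^sub>0 'f)" for a b :: "nat \<times> nat"
    by (simp add: single_mult_single_words)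
  from r show ?thesis
    unfolding fk_relations_def
  proof (elim UnE insertE emptyE CollectE exE conjE)
    fix m assume *: "r = gen m (m + 1) * gen m (m + 1)" "1 \<le> m" "m \<le> n - 1"
    then show ?thesis
      using n gen(1)[of m] by (intro that(1)[of m m]) (auto simp: word2)
  next
    assume "r = gen 1 n * gen 1 n"
    then show ?thesis
      using n gen(5) by (intro that(1)[of n n]) (auto simp: word2)
  next
    fix m assume *: "r = gen m (m + 1) * gen (m + 1) (m + 2)" "1 \<le> m" "m \<le> n - 2"
    then show ?thesis
      using n gen(1)[of m] gen(2)[of m] by (intro that(1)[of m "Suc m"]) (auto simp: word2)
  next
    fix m assume *: "r = gen (m + 1) (m + 2) * gen m (m + 1)" "1 \<le> m" "m \<le> n - 2"
    then show ?thesis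
      using n gen(1)[of m] gen(2)[of m] by (intro that(1)[of "Suc m" m]) (auto simp: word2)
  next
    assume "r = gen (n - 1) n * gen 1 n"
    then show ?thesis
      using n gen by (intro that(1)[of "n - 1" n]) (auto simp: word2)
  next
    assume "r = gen 1 n * gen (n - 1) n"
    then show ?thesis
      using n gen by (intro that(1)[of n "n - 1"]) (auto simp: word2)
  next
    assume "r = gen 1 2 * gen 1 n"
    then show ?thesis
      using n gen by (intro that(1)[of 1 n]) (auto simp: word2)
  next
    assume "r = gen 1 n * gen 1 2"
    then show ?thesis
      using n gen by (intro that(1)[of n 1]) (auto simp: word2)
  next
    fix m l assume *: "r = gen m (m + 1) * gen l (l + 1) - gen l (l + 1) * gen m (m + 1)"
      "1 \<le> m" "m \<le> l - 2" "3 \<le> l" "l \<le> n - 1"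
    then show ?thesis
      using n gen(1)[of m] gen(1)[of l] by (intro that(2)[of m l]) (auto simp: word2)
  next
    fix m assume *: "r = gen m (m + 1) * gen 1 n - gen 1 n * gen m (m + 1)" "2 \<le> m" "m \<le> n - 2"
    then show ?thesis
      using n gen(1)[of m] gen(5) by (intro that(2)[of m n]) (auto simp: word2)
  qed
qed

lemma independence_algebra_fk:
  assumes n: "n > 3"
  shows "independence_algebra (cycle_edges n) meets (fk_relations n :: ((nat \<times> nat) list \<Rightarrow>\<^sub>0 'f::field) set)"
proof
  note edges = cycle_edges_image[OF n] and meets = meets_cycle_edge[OF n]
  show "finite (cycle_edges n)" by (simp add: edges)
  show "meets a a" for a by (simp add: meets_def)
  show "meets a b \<Longrightarrow> meets b a" for a b by (auto simp: meets_def)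
  fix r :: "(nat \<times> nat) list \<Rightarrow>\<^sub>0 'f"
  assume "r \<in> fk_relations n"
  with n show "\<exists>a\<in>cycle_edges n. \<exists>b\<in>cycle_edges n.
      if meets a b then r = word [a, b] else r = word [a, b] - word [b, a]"
  proof (cases rule: fk_relation_cases)
    case (1 i j)
    then have "meets (cycle_edge n i) (cycle_edge n j)" by (simp add: meets)
    then show ?thesis using 1 unfolding edges by (metis image_eqI)
  next
    case (2 i j)
    then have "\<not> meets (cycle_edge n i) (cycle_edge n j)" and "i \<in> {1..n}" "j \<in> {1..n}"
      by (auto simp: meets)
    then show ?thesis using 2(5) unfolding edges by (metis image_eqI)
  qed
next
  fix a b assume "a \<in> cycle_edges n" "b \<in> cycle_edges n"
  then obtain i j where ij: "i \<in> {1..n}" "j \<in> {1..n}" "a = cycle_edge n i" "b = cycle_edge n j"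
    unfolding cycle_edges_image[OF n] by blast
  show "word [a, b] \<in> (fk_relations n :: ((nat \<times> nat) list \<Rightarrow>\<^sub>0 'f) set)" if "meets a b"
    using that ij conflict_relation_fk[OF n ij(1,2)] meets_cycle_edge[OF n ij(1,2)] by simp
  show "word [a, b] - word [b, a] \<in> (fk_relations n :: ((nat \<times> nat) list \<Rightarrow>\<^sub>0 'f) set) \<or>
      word [b, a] - word [a, b] \<in> (fk_relations n :: ((nat \<times> nat) list \<Rightarrow>\<^sub>0 'f) set)"
    if "\<not> meets a b"
  proof -
    have "1 \<le> i" "i + 2 \<le> j" "j \<le> n" "\<not> (i = 1 \<and> j = n)" if "i < j"
      using that ij \<open>\<not> meets a b\<close> meets_cycle_edge[OF n ij(1,2)] by auto
    moreover have "1 \<le> j" "j + 2 \<le> i" "i \<le> n" "\<not> (j = 1 \<and> i = n)" if "\<not> i < j"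
      using that ij \<open>\<not> meets a b\<close> meets_cycle_edge[OF n ij(1,2)] by auto
    ultimately show ?thesis
      using commuting_relation_fk[OF n, of i j, where ?'f = 'f]
        commuting_relation_fk[OF n, of j i, where ?'f = 'f] ij(3,4) by (cases "i < j") simp_all
  qed
qed

text \<open>Numbering the edges turns matchings of the cycle into sets without cyclically adjacent numbers.\<close>

lemma card_matchings:
  assumes "n > 3"
  shows "card {S. S \<subseteq> cycle_edges n \<and> (\<forall>a\<in>S. \<forall>b\<in>S. meets a b \<longrightarrow> a = b) \<and> card S = d} =
    card (cyclic_sparse_sets n d)"
proof -
  have matching: "(\<forall>a\<in>cycle_edge n ` T. \<forall>b\<in>cycle_edge n ` T. meets a b \<longrightarrow> a = b) \<longleftrightarrow>
      (\<forall>i\<in>T. Suc i \<notin> T) \<and> \<not> (1 \<in> T \<and> n \<in> T)" if T: "T \<subseteq> {1..n}" for T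
  proof -
    have "cycle_edge n i = cycle_edge n j \<longleftrightarrow> i = j" if "i \<in> T" "j \<in> T" for i j
      using inj_cycle_edge[OF assms] that T by (meson inj_on_eq_iff subset_iff)
    moreover have "meets (cycle_edge n i) (cycle_edge n j) \<longleftrightarrow>
        i = j \<or> j = Suc i \<or> i = Suc j \<or> i = 1 \<and> j = n \<or> i = n \<and> j = 1" if "i \<in> T" "j \<in> T" for i j
      using meets_cycle_edge[OF assms] that T by blast
    ultimately have "(\<forall>a\<in>cycle_edge n ` T. \<forall>b\<in>cycle_edge n ` T. meets a b \<longrightarrow> a = b) \<longleftrightarrow>
      (\<forall>i\<in>T. \<forall>j\<in>T. i = j \<or> j = Suc i \<or> i = Suc j \<or> i = 1 \<and> j = n \<or> i = n \<and> j = 1 \<longrightarrow> i = j)"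
      by (simp cong: ball_cong)
    also have "\<dots> \<longleftrightarrow> (\<forall>i\<in>T. Suc i \<notin> T) \<and> \<not> (1 \<in> T \<and> n \<in> T)"
    proof
      assume L: "\<forall>i\<in>T. \<forall>j\<in>T. i = j \<or> j = Suc i \<or> i = Suc j \<or> i = 1 \<and> j = n \<or> i = n \<and> j = 1 \<longrightarrow> i = j"
      have "Suc i \<notin> T" if "i \<in> T" for i
        using L[rule_format, of i "Suc i"] that by auto
      moreover have "\<not> (1 \<in> T \<and> n \<in> T)"
        using L[rule_format, of 1 n] assms by auto
      ultimately show "(\<forall>i\<in>T. Suc i \<notin> T) \<and> \<not> (1 \<in> T \<and> n \<in> T)" by blast
    qed auto
    finally show ?thesis .
  qed
  have card_eq: "card (cycle_edge n ` T) = card T" if "T \<subseteq> {1..n}" for T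
    using inj_cycle_edge[OF assms] that by (meson card_image inj_on_subset)
  have "{S. S \<subseteq> cycle_edges n \<and> (\<forall>a\<in>S. \<forall>b\<in>S. meets a b \<longrightarrow> a = b) \<and> card S = d} =
      image (cycle_edge n) ` cyclic_sparse_sets n d"
    (is "?L = ?R")
  proof (intro equalityI subsetI)
    fix S assume S: "S \<in> ?L"
    then obtain T where T: "T \<subseteq> {1..n}" "S = cycle_edge n ` T"
      unfolding cycle_edges_image[OF assms] mem_Collect_eq subset_image_iff by blast
    then have "T \<in> cyclic_sparse_sets n d"
      using S matching[OF T(1)] card_eq[OF T(1)] by (simp add: cyclic_sparse_sets_def)
    then show "S \<in> ?R" using T(2) by blast
  next
    fix S assume "S \<in> ?R"
    then obtain T where T: "T \<in> cyclic_sparse_sets n d" "S = cycle_edge n ` T"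
      by blast
    then have T': "T \<subseteq> {1..n}" by (simp add: cyclic_sparse_sets_def)
    then have "S \<subseteq> cycle_edges n"
      unfolding T(2) cycle_edges_image[OF assms] by (rule image_mono)
    then show "S \<in> ?L"
      using T matching[OF T'] card_eq[OF T'] by (simp add: cyclic_sparse_sets_def)
  qed
  moreover have "inj_on (image (cycle_edge n)) (cyclic_sparse_sets n d)"
    by (rule inj_on_subset[OF inj_on_image_Pow[OF inj_cycle_edge[OF assms]]])
       (auto simp: cyclic_sparse_sets_def)
  ultimately show ?thesis
    by (simp add: card_image)
qed


section \<open>The Hilbert series\<close>

lemma dimension_fk_component:
  assumes "n > 3"
  shows "ring.dimension (fk_cycle n) (card (cyclic_sparse_sets n d))
     (fk_scalars n :: ((nat \<times> nat) list \<Rightarrow>\<^sub>0 'f::field) set set) (fk_component n d)"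
    and "subfield (fk_scalars n :: ((nat \<times> nat) list \<Rightarrow>\<^sub>0 'f::field) set set) (fk_cycle n)"
    and "ring (fk_cycle n :: ((nat \<times> nat) list \<Rightarrow>\<^sub>0 'f::field) set ring)"
proof -
  interpret fk: independence_algebra "cycle_edges n" meets
      "fk_relations n :: ((nat \<times> nat) list \<Rightarrow>\<^sub>0 'f) set"
    by (rule independence_algebra_fk[OF assms])
  have I: "fk_ideal n = fk.I"
    by (simp add: fk_ideal_def fk.I_def)
  have cls: "fk_class n = fk.cls"
    by (simp add: fun_eq_iff fk_class_def fk.cls_def I)
  have scalars: "fk_scalars n = fk.scalars"
    by (simp add: fk_scalars_def fk.scalars_def cls)
  show "ring (fk_cycle n :: ((nat \<times> nat) list \<Rightarrow>\<^sub>0 'f) set ring)"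
    unfolding fk_cycle_def I by (rule ideal.quotient_is_ring[OF fk.ideal_I])
  show "subfield (fk_scalars n :: ((nat \<times> nat) list \<Rightarrow>\<^sub>0 'f) set set) (fk_cycle n)"
    unfolding fk_cycle_def I scalars by (rule fk.subfield_scalars)
  have "{S. fk.indep S \<and> card S = d} =
      {S. S \<subseteq> cycle_edges n \<and> (\<forall>a\<in>S. \<forall>b\<in>S. meets a b \<longrightarrow> a = b) \<and> card S = d}"
    by (auto simp: fk.indep_def)
  then show "ring.dimension (fk_cycle n) (card (cyclic_sparse_sets n d))
     (fk_scalars n :: ((nat \<times> nat) list \<Rightarrow>\<^sub>0 'f) set set) (fk_component n d)"
    using fk.dimension_component[of d] card_matchings[OF assms, of d]
    by (simp add: fk_cycle_def fk_component_def I cls scalars)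
qed

lemma fk_dim_eq:
  assumes "n > 3"
  shows "fk_dim TYPE('f::field) n d = card (cyclic_sparse_sets n d)"
proof -
  interpret ring "fk_cycle n :: ((nat \<times> nat) list \<Rightarrow>\<^sub>0 'f) set ring"
    by (rule dimension_fk_component(3)[OF assms])
  note dim = dimension_fk_component(1)[OF assms, of d, where ?'f = 'f]
  show ?thesis
    unfolding fk_dim_def
    using dim dimension_is_inj[OF dimension_fk_component(2)[OF assms] _ dim]
    by (rule the_equality)
qed

theorem proposition2p16:
  fixes n :: nat
  assumes "n > 3"
  shows "(\<forall>d. \<exists>k. ring.dimension (fk_cycle n) k
            (fk_scalars n :: ((nat \<times> nat) list \<Rightarrow>\<^sub>0 'f::field) set set) (fk_component n d)) \<and>
         hilbert_series TYPE('f) n =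
           (\<Sum>k = 0..n div 2. fps_const (of_nat n / of_nat (n - k) * of_nat ((n - k) choose k)) * fps_X ^ k) \<and>
         (\<Sum>k = 0..n div 2. fps_const (of_nat n / of_nat (n - k) * of_nat ((n - k) choose k)) * fps_X ^ k)
           = fps_of_poly (q_lucas n)"
proof (intro conjI allI)
  show "\<exists>k. ring.dimension (fk_cycle n) k
      (fk_scalars n :: ((nat \<times> nat) list \<Rightarrow>\<^sub>0 'f::field) set set) (fk_component n d)" for d
    using dimension_fk_component(1)[OF assms] by blast
  show "hilbert_series TYPE('f) n =
      (\<Sum>k = 0..n div 2. fps_const (of_nat n / of_nat (n - k) * of_nat ((n - k) choose k)) * fps_X ^ k)"
  proof (rule fps_ext)
    fix d
    show "fps_nth (hilbert_series TYPE('f) n) d = fps_nth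
      (\<Sum>k = 0..n div 2. fps_const (of_nat n / of_nat (n - k) * of_nat ((n - k) choose k)) * fps_X ^ k) d"
      by (simp add: hilbert_series_def fk_dim_eq[OF assms] card_cyclic_sparse_sets_lucas[OF assms]
            fps_sum_nth fps_X_power_nth if_distrib cong: if_cong)
  qed
  show "(\<Sum>k = 0..n div 2. fps_const (of_nat n / of_nat (n - k) * of_nat ((n - k) choose k)) * fps_X ^ k)
      = fps_of_poly (q_lucas n)"
    using assms by (simp add: q_lucas_def fps_of_poly_sum fps_of_poly_monom)
qed

end
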